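(* For any $\epsilon>0$, there exists a linear congestion game with restricted altruistic social context $(\mathcal{G},\Gamma)$, normalized so that $\gamma_{ii}=1$ for all $i$, such that $\Gamma$ is a symmetric boolean matrix (all entries in $\{0,1\}$), for which $\mathsf{PoS}(\mathcal{G},\Gamma)\ge 1+\frac{1}{\sqrt{2}}-\epsilon$.
   Context: Linear congestion game: a set of players $[n]=\{1,\dots,n\}$, $n\ge 2$, a finite set $E$ of resources, for each player $i$ a non-empty set $S_i\subseteq 2^E$ of strategies (each strategy is a non-empty subset of $E$), and for each $e\in E$ a latency function $\ell_e(x)=\alpha_e x+\beta_e$ with $\alpha_e,\beta_e\ge 0$. A strategy profile is $S=(s_1,\dots,s_n)$ with $s_i\in S_i$. The congestion of $e$ in $S$ is $n_e(S)=|\{j\in[n]:e\in s_j\}|$, and the cost of player $i$ in the underlying game is $c_i(S)=\sum_{e\in s_i}(\alpha_e n_e(S)+\beta_e)$. For $t\in S_i$, $S_{-i}\diamond t$ denotes the profile obtained from $S$ by replacing $s_i$ with $t$. A linear congestion game with altruistic social context is a pair $(\mathcal{G},\Gamma)$ where $\mathcal{G}$ is a linear congestion game with $n$ players and $\Gamma=(\gamma_{ij})\in\mathbb{R}^{n\times n}$ has non-negative entries; players and strategies are those of $\mathcal{G}$, but the cost of player $i$ in $S$ is $\widehat{c}_i(S)=\sum_{j\in[n]}\gamma_{ij}\,c_j(S)$. The social context is restricted if $\gamma_{ii}\ge\gamma_{ij}$ for all $i,j$; in this case it is normalized so that $\gamma_{ii}=1$ for every $i$. A pure Nash equilibrium of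 $(\mathcal{G},\Gamma)$ is a profile $S$ with $\widehat{c}_i(S)\le\widehat{c}_i(S_{-i}\diamond t)$ for every player $i$ and every $t\in S_i$. The social function is $\mathsf{SUM}(S)=\sum_{i\in[n]}c_i(S)$ (sum of the costs in the underlying game), and $S^*$ is a profile minimizing it. The price of stability $\mathsf{PoS}(\mathcal{G},\Gamma)$ is the minimum of $\mathsf{SUM}(S)/\mathsf{SUM}(S^* )$ over pure Nash equilibria $S$ of $(\mathcal{G},\Gamma)$ (the set of pure Nash equilibria being non-empty). *)

theory Defs
  imports Complex_Main "HOL-Library.FuncSet"
begin

text \<open>The latency of a resource \<open>e\<close> is \<open>\<ell>\<^sub>e(x) = slope e * x + offset e\<close>.\<close>

record 'e congestion_game =
  num_players :: nat
  resources :: "'e set"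
  strategies :: "nat \<Rightarrow> 'e set set"
  slope :: "'e \<Rightarrow> real"
  offset :: "'e \<Rightarrow> real"

definition players :: "'e congestion_game \<Rightarrow> nat set" where
  "players G = {1..num_players G}"

definition linear_congestion_game :: "'e congestion_game \<Rightarrow> bool" where
  "linear_congestion_game G \<longleftrightarrow>
     num_players G \<ge> 2 \<and>
     finite (resources G) \<and>
     (\<forall>i\<in>players G. strategies G i \<noteq> {} \<and>
        (\<forall>s\<in>strategies G i. s \<noteq> {} \<and> s \<subseteq> resources G)) \<and>
     (\<forall>e\<in>resources G. slope G e \<ge> 0 \<and> offset G e \<ge> 0)"

definition latency :: "'e congestion_game \<Rightarrow> 'e \<Rightarrow> real \<Rightarrow> real" where
  "latency G e x = slope G e * x + offset G e"

text \<open>Profiles are extensional functions, so that a game has only finitely many of them.\<close>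

definition profiles :: "'e congestion_game \<Rightarrow> (nat \<Rightarrow> 'e set) set" where
  "profiles G = PiE (players G) (strategies G)"

definition congestion :: "'e congestion_game \<Rightarrow> (nat \<Rightarrow> 'e set) \<Rightarrow> 'e \<Rightarrow> nat" where
  "congestion G S e = card {j \<in> players G. e \<in> S j}"

definition cost :: "'e congestion_game \<Rightarrow> (nat \<Rightarrow> 'e set) \<Rightarrow> nat \<Rightarrow> real" where
  "cost G S i = (\<Sum>e\<in>S i. latency G e (real (congestion G S e)))"

definition social_cost :: "'e congestion_game \<Rightarrow> (nat \<Rightarrow> 'e set) \<Rightarrow> real" where
  "social_cost G S = (\<Sum>i\<in>players G. cost G S i)"

definition optimal_profile :: "'e congestion_game \<Rightarrow> (nat \<Rightarrow> 'e set)" where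
  "optimal_profile G = arg_min_on (social_cost G) (profiles G)"

text \<open>Only the entries \<open>\<Gamma> i j\<close> with both indices in \<open>players G\<close> are relevant.\<close>

definition altruistic_context :: "'e congestion_game \<Rightarrow> (nat \<Rightarrow> nat \<Rightarrow> real) \<Rightarrow> bool" where
  "altruistic_context G \<Gamma> \<longleftrightarrow> (\<forall>i\<in>players G. \<forall>j\<in>players G. \<Gamma> i j \<ge> 0)"

definition restricted_context :: "'e congestion_game \<Rightarrow> (nat \<Rightarrow> nat \<Rightarrow> real) \<Rightarrow> bool" where
  "restricted_context G \<Gamma> \<longleftrightarrow> (\<forall>i\<in>players G. \<forall>j\<in>players G. \<Gamma> i i \<ge> \<Gamma> i j)"

definition normalized_context :: "'e congestion_game \<Rightarrow> (nat \<Rightarrow> nat \<Rightarrow> real) \<Rightarrow> bool" where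
  "normalized_context G \<Gamma> \<longleftrightarrow> (\<forall>i\<in>players G. \<Gamma> i i = 1)"

definition symmetric_context :: "'e congestion_game \<Rightarrow> (nat \<Rightarrow> nat \<Rightarrow> real) \<Rightarrow> bool" where
  "symmetric_context G \<Gamma> \<longleftrightarrow> (\<forall>i\<in>players G. \<forall>j\<in>players G. \<Gamma> i j = \<Gamma> j i)"

definition boolean_context :: "'e congestion_game \<Rightarrow> (nat \<Rightarrow> nat \<Rightarrow> real) \<Rightarrow> bool" where
  "boolean_context G \<Gamma> \<longleftrightarrow> (\<forall>i\<in>players G. \<forall>j\<in>players G. \<Gamma> i j \<in> {0, 1})"

definition perceived_cost ::
  "'e congestion_game \<Rightarrow> (nat \<Rightarrow> nat \<Rightarrow> real) \<Rightarrow> (nat \<Rightarrow> 'e set) \<Rightarrow> nat \<Rightarrow> real" where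
  "perceived_cost G \<Gamma> S i = (\<Sum>j\<in>players G. \<Gamma> i j * cost G S j)"

definition pure_nash_equilibria ::
  "'e congestion_game \<Rightarrow> (nat \<Rightarrow> nat \<Rightarrow> real) \<Rightarrow> (nat \<Rightarrow> 'e set) set" where
  "pure_nash_equilibria G \<Gamma> =
     {S \<in> profiles G. \<forall>i\<in>players G. \<forall>t\<in>strategies G i.
        perceived_cost G \<Gamma> S i \<le> perceived_cost G \<Gamma> (S(i := t)) i}"

text \<open>Meaningful only if there is a pure Nash equilibrium and the optimal social cost is
  positive: \<^const>\<open>Min\<close> is unspecified on the empty set, and division by zero yields zero.\<close>

definition price_of_stability :: "'e congestion_game \<Rightarrow> (nat \<Rightarrow> nat \<Rightarrow> real) \<Rightarrow> real" where
  "price_of_stability G \<Gamma> =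
     Min ((\<lambda>S. social_cost G S / social_cost G (optimal_profile G)) ` pure_nash_equilibria G \<Gamma>)"

lemma finite_profiles:
  assumes "linear_congestion_game G"
  shows "finite (profiles G)"
  unfolding profiles_def
proof (rule finite_PiE)
  show "finite (players G)" by (simp add: players_def)
  fix i assume "i \<in> players G"
  then have "strategies G i \<subseteq> Pow (resources G)"
    using assms by (auto simp: linear_congestion_game_def)
  then show "finite (strategies G i)"
    using assms by (meson finite_Pow_iff finite_subset linear_congestion_game_def)
qed

lemma finite_pure_nash_equilibria:
  assumes "linear_congestion_game G"
  shows "finite (pure_nash_equilibria G \<Gamma>)"
  using finite_profiles[OF assms] by (simp add: pure_nash_equilibria_def)

lemma optimal_profile:
  assumes "linear_congestion_game G"
  shows "optimal_profile G \<in> profiles G"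
    and "S \<in> profiles G \<Longrightarrow> social_cost G (optimal_profile G) \<le> social_cost G S"
proof -
  have ne: "profiles G \<noteq> {}"
    using assms by (auto simp: profiles_def PiE_eq_empty_iff linear_congestion_game_def)
  show "optimal_profile G \<in> profiles G"
    unfolding optimal_profile_def by (rule arg_min_if_finite(1)[OF finite_profiles[OF assms] ne])
  show "social_cost G (optimal_profile G) \<le> social_cost G S" if "S \<in> profiles G"
    unfolding optimal_profile_def by (rule arg_min_least[OF finite_profiles[OF assms] ne that])
qed

end

theory Submission
  imports Defs "HOL-Library.Nat_Bijection" "HOL-Real_Asymp.Real_Asymp"
begin

text \<open>Two teams of \<open>n\<close> players choose between two strategies \<open>opt\<close> and \<open>nash\<close>, with \<open>\<gamma> = 1\<close> exactly
  between members of different teams. An \<open>opt\<close> player and a rival playing \<open>nash\<close> meet on a resource,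
  a collision whose cost both perceive doubled, whereas the \<open>nash\<close> players of a team meet each other
  and \<open>m\<close> immobile players on a shared resource, a congestion they perceive only once.
  With \<open>x\<close> of the other members of its team and \<open>y\<close> of its rivals playing \<open>nash\<close>, a player perceives
  \<open>nash\<close> as cheaper by \<open>1 + 4 (y - x)\<close>, so \<open>nash\<close> spreads over both teams until it is the only
  equilibrium. The two uniform profiles have costs in the ratio \<open>5 + 8\<mu> + 4\<mu>\<^sup>2\<close> to \<open>3 + 4\<mu> + 4\<mu>\<^sup>2\<close>
  up to \<open>O(1/n)\<close>, where \<open>\<mu> = m/n\<close>, and this is maximal, with value \<open>1 + 1/\<surd>2\<close>, at
  \<open>\<mu> = (\<surd>2 - 1)/2\<close>.\<close>

section \<open>Perceived cost of a unilateral deviation\<close>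

text \<open>The part of the perceived cost of \<open>i\<close> that depends on its own strategy \<open>t\<close>: on each resource of
  \<open>t\<close>, another user \<open>j\<close> slows \<open>i\<close> down by one slope, and is slowed down by as much, weighted \<open>\<Gamma> i j\<close>.\<close>

definition marginal_cost ::
  "'e congestion_game \<Rightarrow> (nat \<Rightarrow> nat \<Rightarrow> real) \<Rightarrow> (nat \<Rightarrow> 'e set) \<Rightarrow> nat \<Rightarrow> 'e set \<Rightarrow> real" where
  "marginal_cost G \<Gamma> S i t =
     (\<Sum>e\<in>t. slope G e * (1 + (\<Sum>j | j \<in> players G - {i} \<and> e \<in> S j. 1 + \<Gamma> i j)) + offset G e)"

lemma finite_players [simp]: "finite (players G)"
  by (simp add: players_def)

lemma congestion_update:
  assumes "i \<in> players G"
  shows "congestion G (S(i := t)) e =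
           card {k \<in> players G - {i}. e \<in> S k} + (if e \<in> t then 1 else 0)"
proof -
  have "{k \<in> players G. e \<in> (S(i := t)) k} =
        (if e \<in> t then insert i {k \<in> players G - {i}. e \<in> S k} else {k \<in> players G - {i}. e \<in> S k})"
    using assms by auto
  then show ?thesis
    by (simp add: congestion_def)
qed

text \<open>The second summand does not mention \<open>t\<close>, so comparing two strategies of
  \<open>i\<close> against fixed opponents amounts to comparing their marginal costs.\<close>

lemma perceived_cost_update:
  assumes i: "i \<in> players G" and "\<Gamma> i i = 1"
    and t: "finite t" and S: "\<And>j. j \<in> players G \<Longrightarrow> finite (S j)"
  shows "perceived_cost G \<Gamma> (S(i := t)) i = marginal_cost G \<Gamma> S i t +
    (\<Sum>j\<in>players G - {i}. \<Gamma> i j *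
       (\<Sum>e\<in>S j. latency G e (card {k \<in> players G - {i}. e \<in> S k})))"
proof -
  define K where "K e = card {k \<in> players G - {i}. e \<in> S k}" for e
  let ?P = "players G - {i}"
  have own: "cost G (S(i := t)) i = (\<Sum>e\<in>t. slope G e * (1 + real (K e)) + offset G e)"
    unfolding cost_def
    by (rule sum.cong) (auto simp: congestion_update[OF i] latency_def K_def)
  have other: "cost G (S(i := t)) j =
      (\<Sum>e\<in>S j. latency G e (K e)) + (\<Sum>e\<in>t. if e \<in> S j then slope G e else 0)"
    if j: "j \<in> ?P" for j
  proof -
    have "cost G (S(i := t)) j = (\<Sum>e\<in>S j. latency G e (K e) + (if e \<in> t then slope G e else 0))"
      using j unfolding cost_def
      by (intro sum.cong) (auto simp: congestion_update[OF i] latency_def K_def algebra_simps)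
    also have "(\<Sum>e\<in>S j. if e \<in> t then slope G e else 0) = (\<Sum>e\<in>t. if e \<in> S j then slope G e else 0)"
      using t S[of j] j by (simp add: sum.inter_restrict[symmetric] Int_commute)
    ultimately show ?thesis
      by (simp add: sum.distrib)
  qed
  \<comment> \<open>The delay that \<open>i\<close> inflicts on others is regrouped from the delayed
    players to the resources of \<open>t\<close>, the form in which \<open>marginal_cost\<close>
    counts it.\<close>
  have "(\<Sum>j\<in>?P. \<Gamma> i j * (\<Sum>e\<in>t. if e \<in> S j then slope G e else 0)) =
        (\<Sum>e\<in>t. \<Sum>j\<in>?P. if e \<in> S j then slope G e * \<Gamma> i j else 0)"
    by (subst sum.swap) (auto simp: sum_distrib_left intro!: sum.cong)
  also have "\<dots> = (\<Sum>e\<in>t. slope G e * (\<Sum>j | j \<in> ?P \<and> e \<in> S j. \<Gamma> i j))"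
    by (intro sum.cong refl, subst sum.inter_filter[symmetric]) (auto simp: sum_distrib_left)
  finally have ext: "(\<Sum>j\<in>?P. \<Gamma> i j * (\<Sum>e\<in>t. if e \<in> S j then slope G e else 0)) =
        (\<Sum>e\<in>t. slope G e * (\<Sum>j | j \<in> ?P \<and> e \<in> S j. \<Gamma> i j))" .
  have "perceived_cost G \<Gamma> (S(i := t)) i =
      cost G (S(i := t)) i + (\<Sum>j\<in>?P. \<Gamma> i j * cost G (S(i := t)) j)"
    using assms by (simp add: perceived_cost_def sum.remove)
  also have "(\<Sum>j\<in>?P. \<Gamma> i j * cost G (S(i := t)) j) =
      (\<Sum>j\<in>?P. \<Gamma> i j * (\<Sum>e\<in>S j. latency G e (K e)))
      + (\<Sum>e\<in>t. slope G e * (\<Sum>j | j \<in> ?P \<and> e \<in> S j. \<Gamma> i j))"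
    unfolding ext[symmetric] sum.distrib[symmetric]
    by (rule sum.cong) (simp_all add: other distrib_left)
  finally show ?thesis
    unfolding own marginal_cost_def K_def
    by (simp add: sum.distrib distrib_left add_ac fun_upd_def)
qed

section \<open>The two-team game and its social context\<close>

locale two_teams =
  fixes n m :: nat
  assumes n_pos: "n > 0"
begin

definition team :: "bool \<Rightarrow> nat set" where
  "team b = (if b then {n<..2 * n} else {0<..n})"

text \<open>\<open>res i j\<close> is used by \<open>i\<close> when it plays \<open>opt\<close> and by its rival \<open>j\<close> when \<open>j\<close> plays \<open>nash\<close>; \<open>res i i\<close> is
  private to \<open>i\<close>. No player has index 0, which leaves \<open>res 0 j\<close> free for the shared resources.\<close>

definition res :: "nat \<Rightarrow> nat \<Rightarrow> nat" where
  "res i j = prod_encode (i, j)"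

definition shared :: "bool \<Rightarrow> nat" where
  "shared b = res 0 (of_bool b)"

text \<open>The team of \<open>i\<close> is \<open>team (n < i)\<close>, that of its rivals \<open>team (i \<le> n)\<close>.\<close>

definition opt :: "nat \<Rightarrow> nat set" where
  "opt i = insert (res i i) (res i ` team (i \<le> n))"

definition nash :: "nat \<Rightarrow> nat set" where
  "nash i = insert (shared (n < i)) ((\<lambda>j. res j i) ` team (i \<le> n))"

text \<open>A rival's move to \<open>nash\<close> raises the marginal cost of \<open>opt\<close> by
  2 and lowers that of \<open>nash\<close> by 2; slope 4 makes a teammate's move weigh exactly as
  much in the other direction. The offset of the private resources evens out the rest and leaves a
  margin of 1 in favour of \<open>nash\<close> when both teams have equally many other
  \<open>nash\<close> players. The test \<open>i = 0\<close> guards \<open>shared False\<close>,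
  which is \<open>res 0 0\<close> and lies on the diagonal.\<close>

definition game :: "nat congestion_game" where
  "game = \<lparr>num_players = 2 * n + m,
     resources = prod_encode ` ({..2 * n} \<times> {..2 * n}),
     strategies = (\<lambda>i. if i \<le> 2 * n then {opt i, nash i} else {range shared}),
     slope = (\<lambda>e. case prod_decode e of (i, j) \<Rightarrow> if i = 0 then 4 else if i = j then 0 else 1),
     offset = (\<lambda>e. case prod_decode e of (i, j) \<Rightarrow>
                 if i \<noteq> 0 \<and> i = j then 2 * real n + 4 * real m + 5 else 0)\<rparr>"

text \<open>Off the diagonal, the adjacency matrix of the complete bipartite graph between the
  teams; the immobile players, belonging to no team, are isolated.\<close>

definition ctx :: "nat \<Rightarrow> nat \<Rightarrow> real" where
  "ctx i j = of_bool (i = j \<or> (\<exists>b. i \<in> team b \<and> j \<in> team (\<not> b)))"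

definition opt_profile :: "nat \<Rightarrow> nat set" where
  "opt_profile = (\<lambda>i\<in>players game. if i \<le> 2 * n then opt i else range shared)"

definition nash_profile :: "nat \<Rightarrow> nat set" where
  "nash_profile = (\<lambda>i\<in>players game. if i \<le> 2 * n then nash i else range shared)"

section \<open>Which players use which resource\<close>

lemma res_eq_iff [simp]: "res i j = res k l \<longleftrightarrow> i = k \<and> j = l"
  by (simp add: res_def)

lemma shared_eq_iff [simp]: "shared b = shared c \<longleftrightarrow> b = c"
  by (simp add: shared_def)

lemma res_neq_shared [simp]: "i > 0 \<Longrightarrow> res i j \<noteq> shared b" "i > 0 \<Longrightarrow> shared b \<noteq> res i j"
  by (auto simp: shared_def)

lemma slope_res [simp]: "slope game (res i j) = (if i = 0 then 4 else if i = j then 0 else 1)"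
  and offset_res [simp]: "offset game (res i j) =
    (if i \<noteq> 0 \<and> i = j then 2 * real n + 4 * real m + 5 else 0)"
  by (simp_all add: game_def res_def)

lemma slope_shared [simp]: "slope game (shared b) = 4"
  and offset_shared [simp]: "offset game (shared b) = 0"
  by (simp_all add: shared_def)

lemma card_team [simp]: "card (team b) = n"
  and finite_team [simp]: "finite (team b)"
  by (auto simp: team_def)

lemma players_game: "players game = {0<..2 * n + m}"
  by (auto simp: players_def game_def)

lemma players_split:
  "players game = team b \<union> team (\<not> b) \<union> {2 * n<..2 * n + m}"
  "team b \<inter> team (\<not> b) = {}"
  "(team b \<union> team (\<not> b)) \<inter> {2 * n<..2 * n + m} = {}"
  by (auto simp: players_game team_def)

lemma teamD:
  assumes "i \<in> team b"
  shows "i > 0" "i \<le> 2 * n" "(n < i) = b" "(i \<le> n) = (\<not> b)" "i \<in> players game"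
  using assms by (auto simp: team_def players_game split: if_splits)

lemma opt_team: "i \<in> team b \<Longrightarrow> opt i = insert (res i i) (res i ` team (\<not> b))"
  and nash_team: "i \<in> team b \<Longrightarrow> nash i = insert (shared b) ((\<lambda>j. res j i) ` team (\<not> b))"
  by (simp_all add: opt_def nash_def teamD)

lemma finite_opt [simp]: "finite (opt i)" and finite_nash [simp]: "finite (nash i)"
  and finite_range_shared [simp]: "finite (range shared)"
  by (simp_all add: opt_def nash_def)

lemma profile_cases:
  assumes "S \<in> profiles game" and "i \<in> players game"
  obtains b where "i \<in> team b" "S i = opt i"
        | b where "i \<in> team b" "S i = nash i"
        | "i > 2 * n" "S i = range shared"
proof -
  have "S i \<in> strategies game i"
    using assms by (auto simp: profiles_def)
  moreover have "i \<in> team (n < i) \<or> i > 2 * n"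
    using assms(2) by (auto simp: players_game team_def)
  ultimately show ?thesis
    using that by (auto simp: game_def split: if_splits)
qed

lemma team_disjoint: "i \<in> team b \<Longrightarrow> i \<in> team (\<not> b) \<Longrightarrow> False"
  using players_split(2)[of b] by blast

lemma shared_in_opt: "i > 0 \<Longrightarrow> shared b \<notin> opt i"
  by (auto simp: opt_def)

lemma shared_in_nash: "shared b \<in> nash i \<longleftrightarrow> b = (n < i)"
  by (auto simp: nash_def dest: teamD(1))

lemma res_in_opt:
  assumes "i \<in> team b" "j \<in> team (\<not> b)"
  shows "res i j \<in> opt k \<longleftrightarrow> k = i"
  using assms team_disjoint[of i b] by (auto simp: opt_def teamD(4)[OF assms(1)])

lemma res_in_nash:
  assumes "i \<in> team b" "j \<in> team (\<not> b)"
  shows "res i j \<in> nash k \<longleftrightarrow> k = j"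
  using assms teamD(1)[OF assms(1)] by (auto simp: nash_def teamD(4)[OF assms(2)])

text \<open>The shared resource tells the two strategies apart, so in any profile
  \<open>movers\<close> records the choice of every team member.\<close>

lemma opt_neq_nash: "i \<in> team b \<Longrightarrow> opt i \<noteq> nash i"
  using shared_in_opt[of i "n < i"] shared_in_nash[of "n < i" i] teamD(1) by metis

lemma res_users:
  assumes S: "S \<in> profiles game" and k: "k \<in> players game"
    and i: "i \<in> team b" and j: "j \<in> team (\<not> b)"
  shows "res i j \<in> S k \<longleftrightarrow> k = i \<and> S i = opt i \<or> k = j \<and> S j = nash j"
  using S k
proof (cases rule: profile_cases)
  case (1 c)
  then show ?thesis
    using opt_neq_nash[of k c] by (auto simp: res_in_opt[OF i j])
next
  case (2 c)
  then show ?thesis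
    using opt_neq_nash[of k c] by (auto simp: res_in_nash[OF i j])
next
  case 3
  then show ?thesis
    using teamD(1,2)[OF i] teamD(2)[OF j] by auto
qed

lemma shared_users:
  assumes S: "S \<in> profiles game" and k: "k \<in> players game"
  shows "shared b \<in> S k \<longleftrightarrow> k \<in> team b \<and> S k = nash k \<or> k > 2 * n"
  using S k
proof (cases rule: profile_cases)
  case (1 c)
  then show ?thesis
    using opt_neq_nash[of k c] shared_in_opt[of k] teamD(1,2)[of k c] by auto
next
  case (2 c)
  then have "b = c \<longleftrightarrow> k \<in> team b"
    using teamD(3)[of k] by blast
  then show ?thesis
    using 2 teamD(2,3)[of k c] by (auto simp: shared_in_nash)
next
  case 3
  then show ?thesis
    by auto
qed

lemma finite_profile: "S \<in> profiles game \<Longrightarrow> k \<in> players game \<Longrightarrow> finite (S k)"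
  by (erule (1) profile_cases) simp_all

lemma sum_opt:
  fixes f :: "nat \<Rightarrow> real"
  assumes "i \<in> team b"
  shows "sum f (opt i) = f (res i i) + (\<Sum>j\<in>team (\<not> b). f (res i j))"
proof -
  have "res i i \<notin> res i ` team (\<not> b)"
    using assms team_disjoint by auto
  then show ?thesis
    using assms by (simp add: opt_team sum.reindex inj_on_def)
qed

lemma sum_nash:
  fixes f :: "nat \<Rightarrow> real"
  assumes "i \<in> team b"
  shows "sum f (nash i) = f (shared b) + (\<Sum>j\<in>team (\<not> b). f (res j i))"
proof -
  have "shared b \<notin> (\<lambda>j. res j i) ` team (\<not> b)"
    by (auto dest: teamD)
  then show ?thesis
    using assms by (simp add: nash_team sum.reindex inj_on_def)
qed

section \<open>Marginal costs of the two strategies\<close>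

definition movers :: "(nat \<Rightarrow> nat set) \<Rightarrow> bool \<Rightarrow> nat set" where
  "movers S b = {i \<in> team b. S i = nash i}"

lemma finite_movers [simp]: "finite (movers S b)"
  by (simp add: movers_def)

lemma ctx_rival: "i \<in> team b \<Longrightarrow> j \<in> team (\<not> b) \<Longrightarrow> ctx i j = 1"
  by (auto simp: ctx_def)

lemma ctx_not_rival: "i \<in> team b \<Longrightarrow> j \<notin> team (\<not> b) \<Longrightarrow> j \<noteq> i \<Longrightarrow> ctx i j = 0"
  using teamD(3) by (auto simp: ctx_def)

text \<open>Beyond the private offset, each of the \<open>n\<close> cross resources costs 1, plus 1
  + 1 if its rival is there too: the delay suffered and the delay caused, which has weight
  1.\<close>

lemma marginal_cost_opt:
  assumes S: "S \<in> profiles game" and i: "i \<in> team b"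
  shows "marginal_cost game ctx S i (opt i) =
           3 * real n + 4 * real m + 5 + 2 * real (card (movers S (\<not> b)))"
proof -
  have "(\<Sum>k | k \<in> players game - {i} \<and> res i j \<in> S k. 1 + ctx i k) = (if j \<in> movers S (\<not> b) then 2 else 0)"
    if j: "j \<in> team (\<not> b)" for j
  proof -
    have "j \<noteq> i"
      using i j team_disjoint by blast
    then have "k \<in> players game - {i} \<and> res i j \<in> S k \<longleftrightarrow> k = j \<and> j \<in> movers S (\<not> b)" for k
      using res_users[OF S _ i j, of k] teamD(5)[OF j] j unfolding movers_def by blast
    then have "{k. k \<in> players game - {i} \<and> res i j \<in> S k} = (if j \<in> movers S (\<not> b) then {j} else {})"
      by auto
    then show ?thesis
      using ctx_rival[OF i j] by simp
  qed
  then have "marginal_cost game ctx S i (opt i) =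
      2 * real n + 4 * real m + 5 + (\<Sum>j\<in>team (\<not> b). 1 + (if j \<in> movers S (\<not> b) then 2 else 0))"
    using teamD(1)[OF i] team_disjoint[OF i]
    unfolding marginal_cost_def sum_opt[OF i]
    by (auto intro!: sum.cong)
  also have "(\<Sum>j\<in>team (\<not> b). 1 + (if j \<in> movers S (\<not> b) then 2 else 0)) =
      real n + 2 * real (card (movers S (\<not> b)))"
  proof -
    have "team (\<not> b) \<inter> movers S (\<not> b) = movers S (\<not> b)"
      by (auto simp: movers_def)
    then show ?thesis
      by (simp add: sum.distrib sum.inter_restrict[symmetric])
  qed
  finally show ?thesis by simp
qed

text \<open>Teammates and immobile players have weight 0, so each counts once, times slope 4, on the
  shared resource. A cross resource costs 3, or only 1 if its rival has left it for
  \<open>nash\<close>. Removing \<open>i\<close> from its own team's movers covers both possible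
  values of \<open>S i\<close>.\<close>

lemma marginal_cost_nash:
  assumes S: "S \<in> profiles game" and i: "i \<in> team b"
  shows "marginal_cost game ctx S i (nash i) =
    3 * real n + 4 * real m + 4 + 4 * real (card (movers S b - {i})) - 2 * real (card (movers S (\<not> b)))"
proof -
  have cross: "(\<Sum>k | k \<in> players game - {i} \<and> res j i \<in> S k. 1 + ctx i k) = (if j \<in> movers S (\<not> b) then 0 else 2)"
    if j: "j \<in> team (\<not> b)" for j
  proof -
    have "j \<noteq> i"
      using i j team_disjoint by blast
    moreover have "S j = opt j \<longleftrightarrow> S j \<noteq> nash j"
      using S teamD(5)[OF j]
      by (cases rule: profile_cases) (use opt_neq_nash[OF j] teamD(2)[OF j] in auto)
    ultimately have "k \<in> players game - {i} \<and> res j i \<in> S k \<longleftrightarrow> k = j \<and> j \<notin> movers S (\<not> b)" for k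
      using res_users[OF S _ j, of k i] teamD(5)[OF j] i j unfolding movers_def by auto
    then have "{k. k \<in> players game - {i} \<and> res j i \<in> S k} = (if j \<in> movers S (\<not> b) then {} else {j})"
      by auto
    then show ?thesis
      using ctx_rival[OF i j] by simp
  qed
  have "(\<Sum>k | k \<in> players game - {i} \<and> shared b \<in> S k. 1 + ctx i k) =
      real (card (movers S b - {i})) + real m"
  proof -
    have "{k. k \<in> players game - {i} \<and> shared b \<in> S k} = (movers S b - {i}) \<union> {2 * n<..2 * n + m}"
      using teamD(2)[OF i] teamD(5)[of _ b]
      by (auto simp: shared_users[OF S] movers_def players_game nash_team)
    moreover have "ctx i k = 0" if "k \<in> (movers S b - {i}) \<union> {2 * n<..2 * n + m}" for k
      using that teamD(2)[OF i] teamD(2)[of k "\<not> b"] team_disjoint[of k b]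
      by (intro ctx_not_rival[OF i]) (auto simp: movers_def)
    moreover have "(movers S b - {i}) \<inter> {2 * n<..2 * n + m} = {}"
      by (auto simp: movers_def dest: teamD(2))
    ultimately show ?thesis
      by (simp add: card_Un_disjoint)
  qed
  moreover have "slope game (res j i) = 1" "offset game (res j i) = 0" if "j \<in> team (\<not> b)" for j
    using i that team_disjoint[of i b] teamD(1)[OF that] by auto
  ultimately have "marginal_cost game ctx S i (nash i) =
      4 * (1 + (real (card (movers S b - {i})) + real m)) +
      (\<Sum>j\<in>team (\<not> b). 3 - (if j \<in> movers S (\<not> b) then 2 else 0))"
    unfolding marginal_cost_def sum_nash[OF i]
    using cross by (auto intro!: sum.cong)
  also have "(\<Sum>j\<in>team (\<not> b). 3 - (if j \<in> movers S (\<not> b) then 2 else 0)) =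
      3 * real n - 2 * real (card (movers S (\<not> b)))"
  proof -
    have "team (\<not> b) \<inter> movers S (\<not> b) = movers S (\<not> b)"
      by (auto simp: movers_def)
    then show ?thesis
      by (simp add: sum_subtractf sum.inter_restrict[symmetric])
  qed
  finally show ?thesis by simp
qed

text \<open>Writing \<open>S\<close> as \<open>S(i := S i)\<close> gives both sides the same
  \<open>t\<close>-independent part, which cancels.\<close>

lemma perceived_cost_le_iff:
  assumes S: "S \<in> profiles game" and i: "i \<in> players game" and t: "finite t"
  shows "perceived_cost game ctx S i \<le> perceived_cost game ctx (S(i := t)) i \<longleftrightarrow>
         marginal_cost game ctx S i (S i) \<le> marginal_cost game ctx S i t"
  using perceived_cost_update[of i game ctx t S] perceived_cost_update[of i game ctx "S i" S]
    finite_profile[OF S] i t by (simp add: ctx_def)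

section \<open>Well-formedness and the unique equilibrium\<close>

lemma game_valid: "linear_congestion_game game"
proof -
  have "opt i \<noteq> {}" "nash i \<noteq> {}" "range shared \<noteq> {}" for i
    by (auto simp: opt_def nash_def)
  \<comment> \<open>\<open>shared True\<close> has second index 1, which lies in the range because
    \<open>n\<close> is positive.\<close>
  moreover have sh: "shared b \<in> prod_encode ` ({..2 * n} \<times> {..2 * n})" for b
    using n_pos by (auto simp: shared_def res_def)
  moreover have "team b \<subseteq> {..2 * n}" for b
    by (auto simp: team_def)
  then have "opt i \<subseteq> prod_encode ` ({..2 * n} \<times> {..2 * n})"
       "nash i \<subseteq> prod_encode ` ({..2 * n} \<times> {..2 * n})" if "i \<le> 2 * n" for i
    using that sh by (auto simp: opt_def nash_def res_def)
  ultimately show ?thesis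
    using n_pos by (auto simp: linear_congestion_game_def game_def split: prod.splits)
qed

lemma opt_profile: "opt_profile \<in> profiles game"
  and nash_profile: "nash_profile \<in> profiles game"
  by (auto simp: opt_profile_def nash_profile_def profiles_def game_def)

lemma opt_profile_team: "i \<in> team b \<Longrightarrow> opt_profile i = opt i"
  and nash_profile_team: "i \<in> team b \<Longrightarrow> nash_profile i = nash i"
  by (simp_all add: opt_profile_def nash_profile_def teamD)

lemma movers_nash_profile: "movers nash_profile b = team b"
  by (auto simp: movers_def nash_profile_team)

text \<open>In a team with no more \<^const>\<open>nash\<close> players than the other, every \<^const>\<open>opt\<close> player strictly
  gains by moving; applied to both teams in turn, this leaves a single equilibrium.\<close>

lemma movers_eq_team:
  assumes S: "S \<in> pure_nash_equilibria game ctx"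
    and le: "card (movers S b) \<le> card (movers S (\<not> b))"
  shows "movers S b = team b"
proof (rule ccontr)
  have prof: "S \<in> profiles game"
    using S by (simp add: pure_nash_equilibria_def)
  assume "movers S b \<noteq> team b"
  then obtain i where i: "i \<in> team b" "i \<notin> movers S b"
    by (auto simp: movers_def)
  have "S i = opt i"
    using prof teamD(5)[OF i(1)]
    by (cases rule: profile_cases) (use i teamD(2)[OF i(1)] in \<open>auto simp: movers_def\<close>)
  moreover have "nash i \<in> strategies game i"
    using teamD(2)[OF i(1)] by (simp add: game_def)
  then have "marginal_cost game ctx S i (S i) \<le> marginal_cost game ctx S i (nash i)"
    using S teamD(5)[OF i(1)]
    by (simp add: pure_nash_equilibria_def perceived_cost_le_iff[OF prof, symmetric])
  moreover have "movers S b - {i} = movers S b"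
    using i by auto
  \<comment> \<open>The marginal cost of \<open>opt\<close> exceeds that of \<open>nash\<close> by 1
    + 4 (y - x), and \<open>le\<close> says x \<le> y.\<close>
  ultimately show False
    using le marginal_cost_opt[OF prof i(1)] marginal_cost_nash[OF prof i(1)] by simp
qed

lemma pure_nash_equilibria_game: "pure_nash_equilibria game ctx = {nash_profile}"
proof (intro equalityI subsetI)
  fix S assume S: "S \<in> pure_nash_equilibria game ctx"
  then have prof: "S \<in> profiles game"
    by (simp add: pure_nash_equilibria_def)
  have "\<exists>b. card (movers S b) \<le> card (movers S (\<not> b))"
    by (cases "card (movers S True) \<le> card (movers S False)") (auto intro: exI[of _ True] exI[of _ False])
  then obtain b where le: "card (movers S b) \<le> card (movers S (\<not> b))" ..
  have b: "movers S b = team b"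
    by (rule movers_eq_team[OF S le])
  have "movers S (\<not> b) \<subseteq> team (\<not> b)"
    by (auto simp: movers_def)
  \<comment> \<open>The smaller set of movers already fills its team, so the larger one has at least
    \<open>n\<close> elements and fills the other.\<close>
  moreover have "card (team (\<not> b)) \<le> card (movers S (\<not> b))"
    using le b by simp
  ultimately have nb: "movers S (\<not> b) = team (\<not> b)"
    by (simp add: card_seteq)
  have mv: "S i = nash i" if "i \<in> team c" for i c
    using b nb that by (cases "c = b") (auto simp: movers_def)
  have "S i = nash_profile i" if "i \<in> players game" for i
    using prof that
    by (cases rule: profile_cases) (use that mv in \<open>auto simp: nash_profile_def teamD(2)\<close>)
  moreover have "S i = nash_profile i" if "i \<notin> players game" for i
    using prof that by (auto simp: nash_profile_def profiles_def PiE_def extensional_def)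
  ultimately show "S \<in> {nash_profile}"
    by auto
next
  fix S assume "S \<in> {nash_profile}"
  then have S: "S = nash_profile" by simp
  have "marginal_cost game ctx S i (S i) \<le> marginal_cost game ctx S i t \<and> finite t"
    if i: "i \<in> players game" and t: "t \<in> strategies game i" for i t
  proof (cases "i \<le> 2 * n")
    case False
    then show ?thesis
      using i t by (auto simp: S game_def nash_profile_def)
  next
    case True
    then obtain b where b: "i \<in> team b"
      using i by (auto simp: players_split(1)[of True])
    \<comment> \<open>Here x = n - 1 and y = n, so \<open>nash\<close> is cheaper by 5.\<close>
    have "real (card (team b - {i})) = real n - 1"
      using b n_pos by (simp add: of_nat_diff)
    then have "marginal_cost game ctx S i (nash i) \<le> marginal_cost game ctx S i (opt i)"
      using marginal_cost_opt[OF nash_profile b] marginal_cost_nash[OF nash_profile b]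
      by (simp add: S movers_nash_profile)
    then show ?thesis
      using True t b by (auto simp: S game_def nash_profile_team)
  qed
  then show "S \<in> pure_nash_equilibria game ctx"
    using nash_profile by (auto simp: S pure_nash_equilibria_def perceived_cost_le_iff)
qed

section \<open>Social costs and the price of stability\<close>

lemma congestion_res:
  assumes S: "S \<in> profiles game" and i: "i \<in> team b" and j: "j \<in> team (\<not> b)"
  shows "congestion game S (res i j) = of_bool (S i = opt i) + of_bool (S j = nash j)"
proof -
  have "i \<noteq> j"
    using i j team_disjoint by blast
  moreover have "{k \<in> players game. res i j \<in> S k} =
      (if S i = opt i then {i} else {}) \<union> (if S j = nash j then {j} else {})"
    using res_users[OF S _ i j] teamD(5)[OF i] teamD(5)[OF j] by (auto split: if_splits)
  ultimately show ?thesis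
    by (simp add: congestion_def)
qed

lemma congestion_shared:
  assumes S: "S \<in> profiles game"
  shows "congestion game S (shared b) = card (movers S b) + m"
proof -
  have "{k \<in> players game. shared b \<in> S k} = movers S b \<union> {2 * n<..2 * n + m}"
    using teamD(5)[of _ b] by (auto simp: shared_users[OF S] movers_def players_game nash_team)
  moreover have "movers S b \<inter> {2 * n<..2 * n + m} = {}"
    by (auto simp: movers_def dest: teamD(2))
  ultimately show ?thesis
    by (simp add: congestion_def card_Un_disjoint)
qed

lemma social_cost_game:
  assumes "\<And>i b. i \<in> team b \<Longrightarrow> cost game S i = x"
    and "\<And>i. i \<in> {2 * n<..2 * n + m} \<Longrightarrow> cost game S i = y"
  shows "social_cost game S = 2 * real n * x + real m * y"
proof -
  have "sum (cost game S) (team c) = real n * x" for c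
    using assms(1)[of _ c] by simp
  moreover have "sum (cost game S) {2 * n<..2 * n + m} = real m * y"
    using assms(2) by simp
  moreover have "social_cost game S = sum (cost game S) (team True) + sum (cost game S) (team False)
      + sum (cost game S) {2 * n<..2 * n + m}"
    unfolding social_cost_def players_split(1)[of True]
    using players_split(2,3)[of True] by (simp add: sum.union_disjoint)
  ultimately show ?thesis
    by simp
qed

lemma cost_fixed:
  assumes S: "S \<in> profiles game" and i: "i \<in> {2 * n<..2 * n + m}"
  shows "cost game S i = 4 * (card (movers S True) + m) + 4 * (card (movers S False) + m)"
proof -
  have "i \<in> players game"
    using i by (simp add: players_game)
  then have "S i \<in> strategies game i"
    using S by (auto simp: profiles_def)
  then have "S i = {shared True, shared False}"
    using i by (simp add: game_def UNIV_bool insert_commute)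
  then show ?thesis
    by (simp add: cost_def latency_def congestion_shared[OF S])
qed

lemma social_cost_opt_profile:
  "social_cost game opt_profile = 2 * real n * (3 * real n + 4 * real m + 5) + real m * (8 * real m)"
proof (rule social_cost_game)
  have mv: "movers opt_profile b = {}" for b
    by (auto simp: movers_def opt_profile_team opt_neq_nash)
  show "cost game opt_profile i = 8 * real m" if "i \<in> {2 * n<..2 * n + m}" for i
    using cost_fixed[OF opt_profile that] by (simp add: mv)
  fix i b assume i: "i \<in> team b"
  have "latency game (res i j) (congestion game opt_profile (res i j)) = 1" if "j \<in> team (\<not> b)" for j
    using i that opt_neq_nash[OF that] team_disjoint[of i b] teamD(1)[OF i]
    by (auto simp: congestion_res[OF opt_profile i that] opt_profile_team latency_def)
  then show "cost game opt_profile i = 3 * real n + 4 * real m + 5"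
    using i teamD(1)[OF i] by (simp add: cost_def opt_profile_team sum_opt latency_def)
qed

lemma social_cost_nash_profile:
  "social_cost game nash_profile =
     2 * real n * (5 * real n + 4 * real m) + real m * (8 * (real n + real m))"
proof (rule social_cost_game)
  show "cost game nash_profile i = 8 * (real n + real m)" if "i \<in> {2 * n<..2 * n + m}" for i
    using cost_fixed[OF nash_profile that] by (simp add: movers_nash_profile)
  fix i b assume i: "i \<in> team b"
  have "latency game (res j i) (congestion game nash_profile (res j i)) = 1" if j: "j \<in> team (\<not> b)" for j
    using i j opt_neq_nash[OF j] team_disjoint[of i b] teamD(1)[OF j]
      congestion_res[OF nash_profile j, of i]
    by (auto simp: nash_profile_team latency_def)
  then show "cost game nash_profile i = 5 * real n + 4 * real m"
    using i by (simp add: cost_def nash_profile_team sum_nash latency_def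
        congestion_shared[OF nash_profile] movers_nash_profile)
qed

text \<open>Player 1 alone pays a positive amount, through its private offset under
  \<open>opt\<close> and through the shared resource under \<open>nash\<close>. This makes the
  quotients in the price of stability meaningful.\<close>

lemma social_cost_pos:
  assumes S: "S \<in> profiles game"
  shows "social_cost game S > 0"
proof -
  have nonneg: "latency game e (real k) \<ge> 0" for e k
    by (simp add: latency_def game_def split: prod.splits)
  have one: "1 \<in> team False"
    using n_pos by (simp add: team_def)
  have "cost game S 1 > 0"
    using S teamD(5)[OF one]
  proof (cases rule: profile_cases)
    case (1 b)
    then have "latency game (res 1 1) (congestion game S (res 1 1)) \<le> cost game S 1"
      unfolding cost_def by (intro member_le_sum nonneg) (auto simp: opt_def)
    then show ?thesis
      by (simp add: latency_def)
  next
    case (2 b)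
    then have "latency game (shared b) (congestion game S (shared b)) \<le> cost game S 1"
      unfolding cost_def by (intro member_le_sum nonneg) (auto simp: nash_team)
    moreover have "1 \<in> movers S b"
      using 2 by (simp add: movers_def)
    then have "congestion game S (shared b) > 0"
      using finite_movers by (auto simp: congestion_shared[OF S] card_gt_0_iff simp del: finite_movers)
    ultimately show ?thesis
      by (simp add: latency_def)
  next
    case 3
    then show ?thesis using n_pos by simp
  qed
  also have "cost game S 1 \<le> social_cost game S"
    unfolding social_cost_def
    by (intro member_le_sum teamD(5)[OF one]) (auto simp: cost_def intro: sum_nonneg nonneg)
  finally show ?thesis .
qed

text \<open>The minimum ranges over a single equilibrium. For a lower bound,
  \<open>opt_profile\<close> need only bound the optimal social cost from above: enlarging the
  denominator shrinks the ratio.\<close>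

lemma price_of_stability_ge:
  "price_of_stability game ctx \<ge>
     (5 * real n ^ 2 + 8 * real n * real m + 4 * real m ^ 2) /
     (3 * real n ^ 2 + 4 * real n * real m + 4 * real m ^ 2 + 5 * real n)" (is "_ \<ge> ?a / ?b")
proof -
  have nash_cost: "social_cost game nash_profile = 2 * ?a"
    unfolding social_cost_nash_profile by (simp add: power2_eq_square algebra_simps)
  have opt_cost: "social_cost game opt_profile = 2 * ?b"
    unfolding social_cost_opt_profile by (simp add: power2_eq_square algebra_simps)
  have "?a / ?b = social_cost game nash_profile / social_cost game opt_profile"
    unfolding nash_cost opt_cost by (rule mult_divide_mult_cancel_left[symmetric]) simp
  also have "\<dots> \<le> social_cost game nash_profile / social_cost game (optimal_profile game)"
    using optimal_profile[OF game_valid] opt_profile nash_profile social_cost_pos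
    by (intro divide_left_mono mult_pos_pos) (auto intro: less_imp_le)
  also have "\<dots> = price_of_stability game ctx"
    by (simp add: price_of_stability_def pure_nash_equilibria_game)
  finally show ?thesis .
qed

end

section \<open>Choosing the proportion of immobile players\<close>

lemma ratio_limit:
  fixes \<epsilon> :: real
  assumes "\<epsilon> > 0"
  obtains n m :: nat where "n > 0"
    "1 + 1 / sqrt 2 - \<epsilon> \<le>
     (5 * real n ^ 2 + 8 * real n * real m + 4 * real m ^ 2) /
     (3 * real n ^ 2 + 4 * real n * real m + 4 * real m ^ 2 + 5 * real n)"
proof -
  define \<mu> :: real where "\<mu> = (sqrt 2 - 1) / 2"
  have \<mu>: "\<mu> > 0"
    by (simp add: \<mu>_def)
  \<comment> \<open>The target proportion is irrational, so \<open>m\<close> is rounded down; this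
    costs at most 1/n.\<close>
  define r where "r n = real (nat \<lfloor>\<mu> * real n\<rfloor>) / real n" for n :: nat
  have r: "r \<longlonglongrightarrow> \<mu>"
  proof (rule tendsto_sandwich)
    show "(\<lambda>n. \<mu> - 1 / real n) \<longlonglongrightarrow> \<mu>" "(\<lambda>_. \<mu>) \<longlonglongrightarrow> \<mu>"
      by real_asymp+
    have *: "\<mu> * real n - 1 \<le> real (nat \<lfloor>\<mu> * real n\<rfloor>) \<and> real (nat \<lfloor>\<mu> * real n\<rfloor>) \<le> \<mu> * real n" for n
      using \<mu> by (auto simp: of_nat_nat)
    have bounds: "\<mu> - 1 / real n \<le> r n \<and> r n \<le> \<mu>" if "n > 0" for n
    proof -
      have "\<mu> - 1 / real n = (\<mu> * real n - 1) / real n" "\<mu> = \<mu> * real n / real n"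
        using that by (simp_all add: diff_divide_distrib)
      then show ?thesis
        unfolding r_def using *[of n] by (metis divide_right_mono of_nat_0_le_iff)
    qed
    show "\<forall>\<^sub>F n in sequentially. \<mu> - 1 / real n \<le> r n" "\<forall>\<^sub>F n in sequentially. r n \<le> \<mu>"
      using bounds by (auto intro: eventually_mono[OF eventually_gt_at_top[of 0]])
  qed
  let ?f = "\<lambda>n. (5 + 8 * r n + 4 * r n ^ 2) / (3 + 4 * r n + 4 * r n ^ 2 + 5 / real n)"
  have den: "3 + 4 * \<mu> + 4 * \<mu> ^ 2 > 0"
    using \<mu> by (intro add_pos_nonneg) auto
  have "(\<lambda>n. 5 / real n) \<longlonglongrightarrow> 0"
    by real_asymp
  then have "?f \<longlonglongrightarrow> (5 + 8 * \<mu> + 4 * \<mu> ^ 2) / (3 + 4 * \<mu> + 4 * \<mu> ^ 2 + 0)"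
    using r den by (intro tendsto_intros) auto
  \<comment> \<open>At this \<mu> the denominator is 4 and the numerator is 4 + 2
    \<open>sqrt 2\<close>.\<close>
  also have "(5 + 8 * \<mu> + 4 * \<mu> ^ 2) / (3 + 4 * \<mu> + 4 * \<mu> ^ 2 + 0) = 1 + 1 / sqrt 2"
    using den by (simp add: \<mu>_def field_simps power2_eq_square)
  finally have "\<forall>\<^sub>F n in sequentially. 1 + 1 / sqrt 2 - \<epsilon> < ?f n"
    using assms by (intro order_tendstoD) auto
  with eventually_gt_at_top[of 0] have "\<forall>\<^sub>F n in sequentially. n > 0 \<and> 1 + 1 / sqrt 2 - \<epsilon> < ?f n"
    by eventually_elim simp
  then obtain n where n: "n > 0" "1 + 1 / sqrt 2 - \<epsilon> < ?f n"
    using eventually_happens trivial_limit_sequentially by blast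
  define m where "m = nat \<lfloor>\<mu> * real n\<rfloor>"
  \<comment> \<open>Scaling by the square of \<open>n\<close> turns the proportion
    \<open>r n\<close> back into the integers \<open>n\<close> and \<open>m\<close>.\<close>
  have "?f n = (real n ^ 2 * (5 + 8 * r n + 4 * r n ^ 2)) /
      (real n ^ 2 * (3 + 4 * r n + 4 * r n ^ 2 + 5 / real n))"
    using n by simp
  also have "real n ^ 2 * (5 + 8 * r n + 4 * r n ^ 2) =
      5 * real n ^ 2 + 8 * real n * real m + 4 * real m ^ 2"
    using n by (simp add: r_def m_def[symmetric] field_simps power2_eq_square)
  also have "real n ^ 2 * (3 + 4 * r n + 4 * r n ^ 2 + 5 / real n) =
      3 * real n ^ 2 + 4 * real n * real m + 4 * real m ^ 2 + 5 * real n"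
    using n by (simp add: r_def m_def[symmetric] field_simps power2_eq_square)
  finally show ?thesis
    using n that[of n m] by simp
qed

theorem theorem7:
  fixes \<epsilon> :: real
  assumes "\<epsilon> > 0"
  shows "\<exists>(G :: nat congestion_game) (\<Gamma> :: nat \<Rightarrow> nat \<Rightarrow> real).
           linear_congestion_game G \<and>
           altruistic_context G \<Gamma> \<and>
           restricted_context G \<Gamma> \<and>
           normalized_context G \<Gamma> \<and>
           symmetric_context G \<Gamma> \<and>
           boolean_context G \<Gamma> \<and>
           pure_nash_equilibria G \<Gamma> \<noteq> {} \<and>
           social_cost G (optimal_profile G) > 0 \<and>
           price_of_stability G \<Gamma> \<ge> 1 + 1 / sqrt 2 - \<epsilon>"
proof -
  obtain n m :: nat where n: "n > 0" and le: "1 + 1 / sqrt 2 - \<epsilon> \<le>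
     (5 * real n ^ 2 + 8 * real n * real m + 4 * real m ^ 2) /
     (3 * real n ^ 2 + 4 * real n * real m + 4 * real m ^ 2 + 5 * real n)"
    using ratio_limit[OF assms] .
  interpret two_teams n m
    using n by unfold_locales
  have sym: "ctx i j = ctx j i" for i j
    by (auto simp: ctx_def ex_bool_eq)
  have "altruistic_context game ctx" "restricted_context game ctx" "normalized_context game ctx"
    "symmetric_context game ctx" "boolean_context game ctx"
    using sym by (auto simp: altruistic_context_def restricted_context_def normalized_context_def
        symmetric_context_def boolean_context_def ctx_def)
  moreover have "social_cost game (optimal_profile game) > 0"
    by (intro social_cost_pos optimal_profile game_valid)
  moreover have "price_of_stability game ctx \<ge> 1 + 1 / sqrt 2 - \<epsilon>"
    using le price_of_stability_ge by linarith
  ultimately show ?thesis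
    using game_valid pure_nash_equilibria_game by blast
qed

end
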